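(* Let $u \in \mathbb{T}$ be irrational, let $a \ge 2$ be an integer, and let $v \in \mathbb{T}$ be arbitrary. Then the closure in $\mathbb{T}$ of the set $\{nu + a^n v : n\in\mathbb{N}_0\}$ has Hausdorff dimension $1$.
   Context: $\mathbb{T} := \mathbb{R}/\mathbb{Z}$ with its usual quotient metric, and $\mathbb{N}_0=\{0,1,2,\dots\}$. An element $u\in\mathbb{T}$ is irrational if it is the class of an irrational real number. *)

theory Defs
  imports "HOL-Analysis.Analysis"
begin

section \<open>The circle group $\mathbb{R}/\mathbb{Z}$\<close>

quotient_type circle = real / "\<lambda>x y::real. x - y \<in> \<int>"
proof (rule equivpI)
  show "reflp (\<lambda>x y::real. x - y \<in> \<int>)"
    by (auto simp: reflp_def)
  show "symp (\<lambda>x y::real. x - y \<in> \<int>)"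
    by (metis (mono_tags, lifting) Ints_minus minus_diff_eq sympI)
  show "transp (\<lambda>x y::real. x - y \<in> \<int>)"
    by (rule transpI) (metis (no_types, opaque_lifting) Ints_add diff_add_cancel add_diff_eq)
qed

lift_definition circle_of :: "real \<Rightarrow> circle" is "\<lambda>x. x" .

lemma circle_of_eq_iff: "circle_of x = circle_of y \<longleftrightarrow> x - y \<in> \<int>"
  by transfer simp

lemma circle_of_cases: obtains x where "p = circle_of x"
  by (metis circle_of.abs_eq Quotient_abs_rep Quotient_circle)

instantiation circle :: ab_group_add
begin

lift_definition zero_circle :: circle is "0" .

lift_definition plus_circle :: "circle \<Rightarrow> circle \<Rightarrow> circle" is "(+)"
  by (metis Ints_add add_diff_add)

lift_definition uminus_circle :: "circle \<Rightarrow> circle" is uminus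
  by (metis Ints_minus minus_diff_minus)

lift_definition minus_circle :: "circle \<Rightarrow> circle \<Rightarrow> circle" is "(-)"
  by (metis Ints_diff diff_diff_eq2 add_diff_eq diff_add_eq diff_diff_add add.commute)

instance
  by standard (transfer; simp)+

end

text \<open>The integer multiple \<open>k x\<close> of an element of the abelian group.\<close>

lift_definition circle_mult :: "int \<Rightarrow> circle \<Rightarrow> circle" is "\<lambda>k x. of_int k * x"
  by (metis Ints_mult Ints_of_int right_diff_distrib)

lemma circle_mult_0: "circle_mult 0 p = 0"
  by transfer simp

lemma circle_mult_add: "circle_mult (k + l) p = circle_mult k p + circle_mult l p"
  by transfer (simp add: algebra_simps)

lemma circle_mult_1: "circle_mult 1 p = p"
  by transfer simp

definition circle_irrational :: "circle \<Rightarrow> bool" where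
  "circle_irrational p \<longleftrightarrow> (\<exists>x. x \<notin> \<rat> \<and> p = circle_of x)"

text \<open>The quotient metric: the least distance between representatives.\<close>

instantiation circle :: metric_space
begin

definition dist_circle :: "circle \<Rightarrow> circle \<Rightarrow> real" where
  "dist_circle p q = Inf {\<bar>x - y\<bar> | x y. circle_of x = p \<and> circle_of y = q}"

definition uniformity_circle :: "(circle \<times> circle) filter" where
  "uniformity_circle = (INF e\<in>{0<..}. principal {(p, q). dist p q < e})"

definition open_circle :: "circle set \<Rightarrow> bool" where
  "open_circle U \<longleftrightarrow> (\<forall>p\<in>U. \<forall>\<^sub>F (p', q) in uniformity. p' = p \<longrightarrow> q \<in> U)"

lemma dist_circle_of:
  "dist (circle_of x) (circle_of y) = \<bar>x - y - of_int (round (x - y))\<bar>"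
proof -
  have "{\<bar>x' - y'\<bar> | x' y'. circle_of x' = circle_of x \<and> circle_of y' = circle_of y}
      = range (\<lambda>k::int. \<bar>x - y - of_int k\<bar>)" (is "?A = ?B")
  proof (intro equalityI subsetI)
    fix d assume "d \<in> ?A"
    then obtain x' y' where d: "d = \<bar>x' - y'\<bar>" "x' - x \<in> \<int>" "y' - y \<in> \<int>"
      by (auto simp: circle_of_eq_iff)
    then obtain k l where "x' - x = of_int k" "y' - y = of_int l"
      by (auto elim!: Ints_cases)
    then have "x' - y' = x - y - of_int (l - k)"
      by simp
    then show "d \<in> ?B" using d by (metis rangeI)
  next
    fix d assume "d \<in> ?B"
    then obtain k :: int where k: "d = \<bar>(x - of_int k) - y\<bar>"
      by (auto simp: algebra_simps)
    have "circle_of (x - of_int k) = circle_of x"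
      by (simp add: circle_of_eq_iff)
    then show "d \<in> ?A" using k by blast
  qed
  moreover have "Inf ?B = \<bar>x - y - of_int (round (x - y))\<bar>"
  proof (rule cInf_eq_minimum)
    fix d assume "d \<in> ?B"
    then show "\<bar>x - y - of_int (round (x - y))\<bar> \<le> d"
      using round_diff_minimal by auto
  qed auto
  ultimately show ?thesis by (simp add: dist_circle_def)
qed

instance
proof
  fix p q r :: circle
  obtain x where x: "p = circle_of x" by (rule circle_of_cases)
  obtain y where y: "q = circle_of y" by (rule circle_of_cases)
  obtain z where z: "r = circle_of z" by (rule circle_of_cases)
  show "dist p q = 0 \<longleftrightarrow> p = q"
  proof
    assume "dist p q = 0"
    then have "x - y = of_int (round (x - y))"
      by (simp add: x y dist_circle_of)
    then show "p = q" unfolding x y circle_of_eq_iff by (metis Ints_of_int)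
  next
    assume "p = q"
    then show "dist p q = 0" using dist_circle_of[of x x] by (simp add: x)
  qed
  have "\<bar>x - y - of_int (round (x - y))\<bar>
      \<le> \<bar>x - y - of_int (round (x - z) - round (y - z))\<bar>"
    by (rule round_diff_minimal)
  also have "\<dots> \<le> \<bar>x - z - of_int (round (x - z))\<bar> + \<bar>y - z - of_int (round (y - z))\<bar>"
    by simp
  finally show "dist p q \<le> dist p r + dist q r"
    by (simp add: x y z dist_circle_of)
qed (simp_all only: uniformity_circle_def open_circle_def)

end

section \<open>Hausdorff measure and dimension\<close>

text \<open>
  The contribution \<open>(diam U)\<^sup>s\<close> of a covering set, with the conventions that the empty set
  contributes 0 and that a nonempty set contributes 1 when \<open>s = 0\<close>, even if its diameter is 0
  (whereas \<open>0 powr 0 = 0\<close>).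
\<close>

definition diam_power :: "real \<Rightarrow> 'a::metric_space set \<Rightarrow> real" where
  "diam_power s U = (if U = {} then 0 else if s = 0 then 1 else diameter U powr s)"

text \<open>
  Boundedness has to be required because \<open>diameter\<close> is only meaningful for bounded sets. Sequences
  also account for finite covers, since their members may be empty.
\<close>

definition hausdorff_premeasure :: "real \<Rightarrow> real \<Rightarrow> 'a::metric_space set \<Rightarrow> ennreal" where
  "hausdorff_premeasure s \<delta> S =
     Inf {(\<Sum>i. ennreal (diam_power s (U i))) | U :: nat \<Rightarrow> 'a set.
            S \<subseteq> (\<Union>i. U i) \<and> (\<forall>i. bounded (U i) \<and> diameter (U i) \<le> \<delta>)}"

definition hausdorff_measure :: "real \<Rightarrow> 'a::metric_space set \<Rightarrow> ennreal" where
  "hausdorff_measure s S = (SUP \<delta>\<in>{0<..}. hausdorff_premeasure s \<delta> S)"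

text \<open>The infimum is \<open>\<infinity>\<close> if no exponent qualifies.\<close>

definition hausdorff_dim :: "'a::metric_space set \<Rightarrow> ennreal" where
  "hausdorff_dim S = Inf {ennreal s | s. 0 \<le> s \<and> hausdorff_measure s S = 0}"

end

theory Submission
  imports Defs
begin

text \<open>
  Suppose that the closure \<open>S\<close> of the orbit is null in dimension \<open>s < 1\<close>, so that \<open>S\<close> has
  finite covers by arcs of radii \<open>a^(-m)\<close> with \<open>\<Sum> a^(-m s)\<close> arbitrarily small. Whenever
  \<open>n u + a^n v\<close> lies in an arc of radius \<open>a^(-m)\<close>, the phase \<open>n u\<close> and the arc determine, up
  to boundedly many choices, the \<open>m\<close> base-\<open>a\<close> digits of \<open>v\<close> from position \<open>n\<close> on; hence the
  digits of \<open>v\<close> can be parsed into such blocks. If \<open>v\<close> has \<open>O(a^(h l))\<close> words of length \<open>l\<close>,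
  an arc of radius \<open>a^(-m)\<close> is compatible with one of these words only for a set of phases of
  measure \<open>O(a^((h - 1) m))\<close>. Since the phases are equidistributed, at most positions the
  blocks compatible with the phase satisfy a Kraft inequality with exponent \<open>h - (1 - s)\<close>, and
  so \<open>v\<close> has in fact only \<open>O(a^((h - (1 - s) / 2) l))\<close> words of length \<open>l\<close>. Starting from
  \<open>h = 1\<close> and iterating, \<open>h\<close> becomes negative, which is absurd.
\<close>

section \<open>Metric and compactness of the circle\<close>

lemma circle_of_add: "circle_of (x + y) = circle_of x + circle_of y"
  by transfer simp

lemma circle_mult_circle_of: "circle_mult k (circle_of x) = circle_of (of_int k * x)"
  by transfer simp

lemma dist_circle_add_right: "dist (p + r) (q + r) = dist p (q :: circle)"
proof -
  obtain x y z where "p = circle_of x" "q = circle_of y" "r = circle_of z"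
    by (metis circle_of_cases)
  then show ?thesis
    by (simp flip: circle_of_add add: dist_circle_of)
qed

lemma dist_circle_add_left: "dist (r + p) (r + q) = dist p (q :: circle)"
  using dist_circle_add_right[of p r q] by (simp add: add.commute)

lemma dist_circle_of_le: "dist (circle_of x) (circle_of y) \<le> \<bar>x - y\<bar>"
  unfolding dist_circle_of using round_diff_minimal[of "x - y" 0] by simp

lemma dist_circle_of_ge:
  assumes "\<delta> \<le> \<bar>x - y\<bar>" "\<bar>x - y\<bar> \<le> 1 - \<delta>"
  shows "\<delta> \<le> dist (circle_of x) (circle_of y)"
proof -
  define k where "k = round (x - y)"
  have "k = 0 \<or> k \<ge> 1 \<or> k \<le> -1" by linarith
  then have "k = 0 \<or> real_of_int k \<ge> 1 \<or> real_of_int k \<le> -1" by linarith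
  then show ?thesis using assms unfolding dist_circle_of k_def[symmetric] by (elim disjE) auto
qed

lemma circle_of_frac: "circle_of (frac x) = circle_of x"
  by (simp add: circle_of_eq_iff frac_def)

lemma compact_circle: "compact (UNIV :: circle set)"
proof -
  have "continuous_on {0..1} circle_of"
    unfolding continuous_on_iff dist_real_def
    by (intro ballI allI impI) (use dist_circle_of_le le_less_trans in blast)
  then have "compact (circle_of ` {0..1})"
    by (rule compact_continuous_image) auto
  moreover have "circle_of ` {0..1} = UNIV"
  proof -
    have "p \<in> circle_of ` {0..1}" for p
    proof -
      obtain x where x: "p = circle_of x" by (rule circle_of_cases)
      have "p = circle_of (frac x)" by (simp add: x circle_of_frac)
      moreover have "frac x \<in> {0..1}" by (simp add: less_imp_le[OF frac_lt_1])
      ultimately show ?thesis by blast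
    qed
    then show ?thesis by blast
  qed
  ultimately show ?thesis by simp
qed

text \<open>Used to sort the times \<open>n\<close> into finitely many classes by the phase
  \<open>n u\<close>. The centres can be taken in the range itself because balls around its points
  already cover its compact closure.\<close>

lemma finite_net_range:
  fixes f :: "'b \<Rightarrow> circle"
  assumes "\<epsilon> > 0"
  obtains N where "finite N" "\<And>n. \<exists>n0\<in>N. dist (f n) (f n0) < \<epsilon>"
proof -
  have cpt: "compact (closure (range f))"
    using compact_Int_closed[OF compact_circle closed_closure] by simp
  have cover: "closure (range f) \<subseteq> (\<Union>n\<in>UNIV. ball (f n) \<epsilon>)"
  proof
    fix x assume "x \<in> closure (range f)"
    then obtain n where "dist (f n) x < \<epsilon>"
      using assms unfolding closure_approachable by blast
    then show "x \<in> (\<Union>n\<in>UNIV. ball (f n) \<epsilon>)" by auto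
  qed
  obtain N where N: "finite N" "closure (range f) \<subseteq> (\<Union>n\<in>N. ball (f n) \<epsilon>)"
    by (rule compactE_image[OF cpt _ cover]) auto
  have "\<exists>n0\<in>N. dist (f n) (f n0) < \<epsilon>" for n
  proof -
    have "f n \<in> closure (range f)" using closure_subset[of "range f"] by blast
    then have "f n \<in> (\<Union>n\<in>N. ball (f n) \<epsilon>)" using N(2) by (rule rev_subsetD)
    then show ?thesis by (metis UN_E mem_ball dist_commute)
  qed
  with N(1) show ?thesis using that by blast
qed

section \<open>Upper bound for the dimension\<close>

text \<open>Cutting the circle into \<open>N\<close> arcs of length \<open>1 / N\<close> costs
  \<open>N powr (1 - s)\<close>, which tends to 0 for every \<open>s > 1\<close>.\<close>

lemma hausdorff_dim_circle_le_1: "hausdorff_dim (S :: circle set) \<le> 1"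
proof -
  have premeasure_le: "hausdorff_premeasure s \<delta> S \<le> ennreal (real N powr (1 - s))"
    if s: "s > 0" and N: "N > 0" and \<delta>: "1 / real N \<le> \<delta>" for s \<delta> and N :: nat
  proof -
    define U where "U i = (if i < N then circle_of ` {real i / real N .. (real i + 1) / real N} else {})" for i :: nat
    have bd: "dist p q \<le> 1 / real N" if pq: "p \<in> U i" "q \<in> U i" for p q i
    proof -
      obtain x y where xy: "p = circle_of x" "q = circle_of y"
        "x \<in> {real i / real N .. (real i + 1) / real N}" "y \<in> {real i / real N .. (real i + 1) / real N}"
        using pq unfolding U_def by (cases "i < N") auto
      have "dist p q \<le> \<bar>x - y\<bar>" by (simp add: xy dist_circle_of_le)
      also have "\<dots> \<le> (real i + 1) / real N - real i / real N" using xy(3,4) by auto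
      also have "\<dots> = 1 / real N" by (simp add: diff_divide_distrib[symmetric])
      finally show ?thesis .
    qed
    have bdd: "bounded (U i)" for i
      unfolding bounded_def using bd[of _ i] by blast
    have diam: "diameter (U i) \<le> 1 / real N" for i
      unfolding diameter_def by (auto intro!: cSUP_least bd)
    have "S \<subseteq> (\<Union>i. U i)"
    proof
      fix p
      obtain x where x: "p = circle_of x" by (rule circle_of_cases)
      define y where "y = frac x"
      have y: "0 \<le> y" "y < 1" by (simp_all add: y_def frac_lt_1)
      define i where "i = nat \<lfloor>real N * y\<rfloor>"
      have i: "real i \<le> real N * y" "real N * y < real i + 1"
        using y by (simp_all add: i_def)
      have "real N * y < real N * 1" using y N by (intro mult_strict_left_mono) auto
      then have "real i < real N" using i(1) by linarith
      then have "i < N" by simp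
      moreover have "y \<in> {real i / real N .. (real i + 1) / real N}"
        using i N by (auto simp: field_simps)
      moreover have "p = circle_of y" by (simp add: x y_def circle_of_frac)
      ultimately show "p \<in> (\<Union>i. U i)" by (auto simp: U_def)
    qed
    then have "hausdorff_premeasure s \<delta> S \<le> (\<Sum>i. ennreal (diam_power s (U i)))"
      unfolding hausdorff_premeasure_def using bdd order_trans[OF diam \<delta>]
      by (intro Inf_lower CollectI exI[of _ U]) auto
    also have "\<dots> = (\<Sum>i<N. ennreal (diam_power s (U i)))"
      by (rule suminf_finite) (auto simp: U_def diam_power_def)
    also have "\<dots> \<le> (\<Sum>i<N. ennreal ((1 / real N) powr s))"
      using s N diam diameter_ge_0[OF bdd]
      by (intro sum_mono ennreal_leI) (auto simp: diam_power_def intro!: powr_mono2)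
    also have "\<dots> = ennreal (real N * (1 / real N) powr s)"
      by (simp add: ennreal_of_nat_eq_real_of_nat ennreal_mult)
    also have "real N * (1 / real N) powr s = real N powr (1 - s)"
      using s N by (simp add: powr_diff powr_divide)
    finally show ?thesis .
  qed
  have premeasure_eq_0: "hausdorff_premeasure s \<delta> S = 0" if s: "s > 1" and \<delta>: "\<delta> > 0" for s \<delta>
  proof -
    have "((\<lambda>x. x powr (1 - s)) \<longlongrightarrow> 0) at_top"
      using s by (intro tendsto_neg_powr filterlim_ident) simp
    then have "(\<lambda>N. real N powr (1 - s)) \<longlonglongrightarrow> 0"
      by (rule filterlim_compose[OF _ filterlim_real_sequentially])
    then have lim: "(\<lambda>N. ennreal (real N powr (1 - s))) \<longlonglongrightarrow> ennreal 0"
      by (rule tendsto_ennrealI)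
    obtain K :: nat where K: "1 / \<delta> \<le> real K"
      using real_arch_simple by blast
    have bound: "hausdorff_premeasure s \<delta> S \<le> ennreal (real N powr (1 - s))" if N: "N \<ge> Suc K" for N
    proof (rule premeasure_le)
      have "1 / \<delta> \<le> real N" using K N by linarith
      then show "1 / real N \<le> \<delta>" using \<delta> N by (simp add: field_simps)
    qed (use s N in simp_all)
    have "hausdorff_premeasure s \<delta> S \<le> ennreal 0"
      by (rule LIMSEQ_le_const[OF lim]) (use bound in blast)
    then show ?thesis by simp
  qed
  show ?thesis
  proof (rule ennreal_le_epsilon)
    fix e :: real assume "e > 0"
    then have "hausdorff_measure (1 + e) S = 0"
      by (simp add: hausdorff_measure_def premeasure_eq_0)
    then have "hausdorff_dim S \<le> ennreal (1 + e)"
      unfolding hausdorff_dim_def using \<open>e > 0\<close> by (intro Inf_lower CollectI exI[of _ "1 + e"]) simp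
    then show "hausdorff_dim S \<le> 1 + ennreal e"
      using \<open>e > 0\<close> by (simp add: ennreal_plus)
  qed
qed

section \<open>Visits of an irrational rotation to an arc\<close>

text \<open>
  Translating an arc by \<open>K\<close> well separated multiples of \<open>u\<close> gives disjoint arcs, so it is
  visited by at most a fraction \<open>1 / K\<close> of any orbit segment.
\<close>

lemma irrational_visits:
  assumes "circle_irrational u" "r > 0"
  obtains C where "\<And>p k L. real (card {n\<in>{k..<k + L}. dist (circle_mult (int n) u) p < r}) \<le> 8 * r * real L + C"
proof (cases "r < 1 / 4")
  case False
  \<comment> \<open>Here \<open>8 * r\<close> is at least 2, so the trivial count suffices.\<close>
  have "real (card {n\<in>{k..<k + L}. dist (circle_mult (int n) u) p < r}) \<le> 8 * r * real L + 0" for p k L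
  proof -
    have "card {n\<in>{k..<k + L}. dist (circle_mult (int n) u) p < r} \<le> card {k..<k + L}"
      by (intro card_mono) auto
    moreover have "1 * real L \<le> 8 * r * real L" using False by (intro mult_right_mono) auto
    ultimately show ?thesis by simp
  qed
  then show ?thesis by (rule that)
next
  case True
  define \<theta> where "\<theta> n = circle_mult (int n) u" for n
  have \<theta>_add: "\<theta> (m + n) = \<theta> m + \<theta> n" for m n
    by (simp add: \<theta>_def circle_mult_add)
  obtain x where x: "x \<notin> \<rat>" "u = circle_of x"
    using assms(1) by (auto simp: circle_irrational_def)
  \<comment> \<open>The largest \<open>K\<close> for which the points \<open>t / K\<close> are at
    least \<open>4 * r\<close> apart. Since \<open>K\<close> is at least 1,
    \<open>1 / (4 * r) < K + 1\<close> is at most \<open>2 * K\<close>, which is the source of the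
    constant 8.\<close>
  define K where "K = nat \<lfloor>1 / (4 * r)\<rfloor>"
  have "1 / (4 * r) > 1" using True assms(2) by (simp add: field_simps)
  then have K: "real K \<le> 1 / (4 * r)" "1 / (4 * r) < real K + 1" "K \<ge> 1"
    unfolding K_def by linarith+
  have Kr: "4 * r \<le> 1 / real K" using K(1,3) assms(2) by (simp add: field_simps)
  have K8: "1 / real K \<le> 8 * r"
  proof -
    have "1 / (4 * r) < 2 * real K" using K(2,3) by linarith
    then show ?thesis using assms(2) K(3) by (simp add: field_simps)
  qed
  \<comment> \<open>By Kronecker's theorem some multiple of \<open>u\<close> comes within
    \<open>r\<close> of each \<open>t / K\<close>; the multiples found keep a separation of
    \<open>4 * r - 2 * r\<close>.\<close>
  have "\<exists>j. dist (\<theta> j) (circle_of (real t / real K)) < r" if t: "t < K" for t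
  proof -
    obtain j where "\<bar>frac (real j * x) - real t / real K\<bar> < r"
      by (rule Kronecker_approx_1_explicit[OF x(1), of "real t / real K" r]) (use t assms(2) in auto)
    moreover have "\<theta> j = circle_of (frac (real j * x))"
      by (simp add: \<theta>_def x(2) circle_mult_circle_of circle_of_frac)
    ultimately show ?thesis using dist_circle_of_le le_less_trans by metis
  qed
  then obtain j where j: "\<And>t. t < K \<Longrightarrow> dist (\<theta> (j t)) (circle_of (real t / real K)) < r"
    by metis
  have sep: "2 * r \<le> dist (\<theta> (j t)) (\<theta> (j t'))" if "t < K" "t' < K" "t \<noteq> t'" for t t'
  proof -
    have ge1: "1 \<le> \<bar>real t - real t'\<bar>" using that(3) by linarith
    have le1: "\<bar>real t - real t'\<bar> \<le> real K - 1" using that(1,2) by linarith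
    have eq: "\<bar>real t / real K - real t' / real K\<bar> = \<bar>real t - real t'\<bar> / real K"
      by (simp add: diff_divide_distrib[symmetric])
    have "1 / real K \<le> dist (circle_of (real t / real K)) (circle_of (real t' / real K))"
    proof (rule dist_circle_of_ge)
      show "1 / real K \<le> \<bar>real t / real K - real t' / real K\<bar>"
        unfolding eq using ge1 by (intro divide_right_mono) auto
      have "\<bar>real t - real t'\<bar> / real K \<le> (real K - 1) / real K"
        using le1 by (intro divide_right_mono) auto
      also have "\<dots> = 1 - 1 / real K" using K(3) by (simp add: diff_divide_distrib)
      finally show "\<bar>real t / real K - real t' / real K\<bar> \<le> 1 - 1 / real K" unfolding eq .
    qed
    moreover have "dist (circle_of (real t / real K)) (circle_of (real t' / real K)) \<le> 
       dist (circle_of (real t / real K)) (\<theta> (j t)) + dist (\<theta> (j t)) (\<theta> (j t')) + dist (\<theta> (j t')) (circle_of (real t' / real K))"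
      using dist_triangle[of "circle_of (real t / real K)" "circle_of (real t' / real K)" "\<theta> (j t)"]
        dist_triangle[of "\<theta> (j t)" "circle_of (real t' / real K)" "\<theta> (j t')"] by linarith
    ultimately show ?thesis using j[OF that(1)] j[OF that(2)] Kr by (simp add: dist_commute)
  qed
  \<comment> \<open>All shifts of a window of length \<open>L\<close> by the times
    \<open>j t\<close> fit into a window of length \<open>L + J\<close>. As \<open>J\<close> depends
    on neither the arc nor the window, the additive error is uniform.\<close>
  define J where "J = Max (j ` {..<K})"
  have J: "j t \<le> J" if "t < K" for t unfolding J_def using that by (intro Max_ge) auto
  have "real (card {n\<in>{k..<k + L}. dist (circle_mult (int n) u) p < r}) \<le> 8 * r * real L + 8 * r * real J" for p k L
  proof -
    define V where "V = {n\<in>{k..<k + L}. dist (\<theta> n) p < r}"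
    have "card ({..<K} \<times> V) \<le> card {k..<k + L + J}"
    proof (rule card_inj_on_le)
      \<comment> \<open>A collision would make the distance of two separated multiples equal to that
        of two points in one arc of radius \<open>r\<close>.\<close>
      show "inj_on (\<lambda>(t, n). j t + n) ({..<K} \<times> V)"
      proof (rule inj_onI, clarsimp)
        fix t n t' n' assume *: "t < K" "n \<in> V" "t' < K" "n' \<in> V" "j t + n = j t' + n'"
        have "\<theta> (j t) + \<theta> n = \<theta> (j t') + \<theta> n'" using *(5) by (metis \<theta>_add)
        then have "dist (\<theta> (j t) + \<theta> n) (\<theta> (j t') + \<theta> n) = dist (\<theta> (j t') + \<theta> n') (\<theta> (j t') + \<theta> n)"
          by simp
        then have "dist (\<theta> (j t)) (\<theta> (j t')) = dist (\<theta> n') (\<theta> n)"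
          by (simp only: dist_circle_add_right dist_circle_add_left)
        also have "\<dots> < 2 * r"
        proof -
          have "dist (\<theta> n') (\<theta> n) \<le> dist (\<theta> n') p + dist (\<theta> n) p" by (rule dist_triangle2)
          then show ?thesis using * by (auto simp: V_def)
        qed
        finally have "t = t'" using sep[OF *(1,3)] by linarith
        then show "t = t' \<and> n = n'" using *(5) by simp
      qed
      show "(\<lambda>(t, n). j t + n) ` ({..<K} \<times> V) \<subseteq> {k..<k + L + J}"
        using J by (fastforce simp: V_def)
    qed simp
    then have "K * card V \<le> L + J" by (simp add: card_cartesian_product)
    then have "real K * real (card V) \<le> real L + real J" by (metis of_nat_add of_nat_le_iff of_nat_mult)
    then have "real (card V) \<le> (1 / real K) * (real L + real J)" using K(3) by (simp add: field_simps)
    also have "\<dots> \<le> 8 * r * (real L + real J)" by (intro mult_right_mono K8) auto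
    finally show ?thesis by (simp add: V_def \<theta>_def algebra_simps)
  qed
  then show ?thesis by (rule that)
qed

section \<open>Finite ball covers of null sets\<close>

text \<open>A cover at scale 1 suffices: for diameters at most 1, raising the exponent from
  \<open>s0\<close> to \<open>s\<close> only lowers the cost. Small positive radii are cheap because
  \<open>s > 0\<close>, so the sets can be thickened to open balls and compactness applies. Radii
  are rounded to powers of \<open>A\<close> so that they correspond to word lengths.\<close>

lemma hausdorff_null_finite_ball_cover:
  fixes S :: "'a::metric_space set"
  assumes "compact S" "hausdorff_measure s0 S = 0" "s0 < s" "0 < s" "A > 1" "\<eta> > 0"
  obtains I and c :: "nat \<Rightarrow> 'a" and m :: "nat \<Rightarrow> nat"
  where "finite I" "S \<subseteq> (\<Union>i\<in>I. ball (c i) (2 * A powr - real (m i)))"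
    "(\<Sum>i\<in>I. A powr - (real (m i) * s)) < \<eta>"
proof -
  \<comment> \<open>The final cost is below \<open>A powr s * (\<epsilon> + \<epsilon>)\<close>: one
    \<open>\<epsilon>\<close> for the given cover and one for thickening. The bound by 1 keeps each
    \<open>\<tau> i\<close> at most 1.\<close>
  define \<epsilon> where "\<epsilon> = min 1 (\<eta> / (2 * A powr s))"
  have \<epsilon>: "0 < \<epsilon>" "\<epsilon> \<le> 1" "\<epsilon> * (2 * A powr s) \<le> \<eta>"
    using assms(5,6) by (auto simp: \<epsilon>_def min_def field_simps)
  have "hausdorff_premeasure s0 1 S \<le> hausdorff_measure s0 S"
    unfolding hausdorff_measure_def by (rule SUP_upper) simp
  then have "hausdorff_premeasure s0 1 S < ennreal \<epsilon>"
    using assms(2) \<epsilon>(1) by simp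
  then obtain U :: "nat \<Rightarrow> 'a set" where U: "S \<subseteq> (\<Union>i. U i)" "\<And>i. bounded (U i)" "\<And>i. diameter (U i) \<le> 1"
    "(\<Sum>i. ennreal (diam_power s0 (U i))) < ennreal \<epsilon>"
    unfolding hausdorff_premeasure_def Inf_less_iff by auto
  \<comment> \<open>A positive lower bound for the radius, for sets of diameter 0; over all
    \<open>i\<close> the costs \<open>\<tau> i powr s\<close> add up to
    \<open>\<epsilon>\<close>.\<close>
  define \<tau> where "\<tau> i = (\<epsilon> * (1 / 2) ^ Suc i) powr (1 / s)" for i :: nat
  have half: "0 < \<epsilon> * (1 / 2) ^ Suc i" "\<epsilon> * (1 / 2) ^ Suc i \<le> 1" for i :: nat
  proof -
    have "(1 / 2 :: real) ^ Suc i \<le> 1" by (rule power_le_one) auto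
    then show "\<epsilon> * (1 / 2) ^ Suc i \<le> 1" using \<epsilon> by (intro mult_le_one) auto
  qed (use \<epsilon> in auto)
  have \<tau>: "0 < \<tau> i" "\<tau> i \<le> 1" "\<tau> i powr s = \<epsilon> * (1 / 2) ^ Suc i" for i
    using half[of i] assms(4) by (auto simp: \<tau>_def powr_powr intro!: powr_le1)
  define \<rho> where "\<rho> i = max (diameter (U i)) (\<tau> i)" for i
  have \<rho>: "0 < \<rho> i" "\<rho> i \<le> 1" "diameter (U i) \<le> \<rho> i" for i
    using \<tau>[of i] U(3)[of i] by (auto simp: \<rho>_def)
  have \<rho>_powr: "\<rho> i powr s \<le> diam_power s0 (U i) + \<epsilon> * (1 / 2) ^ Suc i" if "U i \<noteq> {}" for i
  proof -
    have d0: "0 \<le> diameter (U i)" by (rule diameter_ge_0[OF U(2)])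
    have "diameter (U i) powr s \<le> diam_power s0 (U i)"
    proof (cases "s0 = 0")
      case True
      then show ?thesis using d0 U(3)[of i] assms(4) that by (simp add: diam_power_def powr_le1)
    next
      case False
      then show ?thesis using d0 U(3)[of i] assms(3) that
        by (cases "diameter (U i) = 0") (auto simp: diam_power_def intro!: powr_mono')
    qed
    moreover have "0 \<le> diam_power s0 (U i)" by (simp add: diam_power_def)
    ultimately show ?thesis using \<tau>(3)[of i] half(1)[of i] by (auto simp: \<rho>_def max_def)
  qed
  \<comment> \<open>The largest exponent with \<open>\<rho> i \<le> A powr - real (m i)\<close>, so
    rounding loses at most a factor \<open>A\<close>; it is a natural number because
    \<open>\<rho> i \<le> 1\<close>.\<close>
  define m where "m i = nat \<lfloor>- log A (\<rho> i)\<rfloor>" for i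
  have m: "\<rho> i \<le> A powr - real (m i)" "A powr - real (m i) \<le> A * \<rho> i" for i
  proof -
    have "log A (\<rho> i) \<le> 0" using \<rho>[of i] assms(5) by simp
    then have mi: "real (m i) \<le> - log A (\<rho> i)" "- log A (\<rho> i) < real (m i) + 1"
      unfolding m_def by linarith+
    have eq: "A powr log A (\<rho> i) = \<rho> i" using \<rho>[of i] assms(5) by simp
    have "A powr log A (\<rho> i) \<le> A powr - real (m i)" using mi assms(5) by (intro powr_mono) auto
    then show "\<rho> i \<le> A powr - real (m i)" unfolding eq .
    have "A powr - real (m i) \<le> A powr (1 + log A (\<rho> i))" using mi assms(5) by (intro powr_mono) auto
    also have "\<dots> = A * \<rho> i" using assms(5) eq by (simp add: powr_add)
    finally show "A powr - real (m i) \<le> A * \<rho> i" .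
  qed
  define c where "c i = (SOME x. x \<in> U i)" for i
  have c: "c i \<in> U i" if "U i \<noteq> {}" for i
    using that unfolding c_def by (metis ex_in_conv someI)
  \<comment> \<open>The factor 2 turns the weak bound by the diameter into a strict one, as the open
    ball requires.\<close>
  have sub: "U i \<subseteq> ball (c i) (2 * A powr - real (m i))" if "U i \<noteq> {}" for i
  proof
    fix x assume "x \<in> U i"
    then have "dist (c i) x \<le> diameter (U i)" using U(2) c that by (intro diameter_bounded_bound) auto
    then show "x \<in> ball (c i) (2 * A powr - real (m i))" using \<rho>[of i] m(1)[of i] by auto
  qed
  have cover: "S \<subseteq> (\<Union>i\<in>{i. U i \<noteq> {}}. ball (c i) (2 * A powr - real (m i)))"
  proof
    fix x assume "x \<in> S"
    then obtain i where "x \<in> U i" using U(1) by blast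
    then show "x \<in> (\<Union>i\<in>{i. U i \<noteq> {}}. ball (c i) (2 * A powr - real (m i)))"
      using sub[of i] by blast
  qed
  obtain I where I: "I \<subseteq> {i. U i \<noteq> {}}" "finite I" "S \<subseteq> (\<Union>i\<in>I. ball (c i) (2 * A powr - real (m i)))"
    by (rule compactE_image[OF assms(1) _ cover]) auto
  have "ennreal (\<Sum>i\<in>I. diam_power s0 (U i)) = (\<Sum>i\<in>I. ennreal (diam_power s0 (U i)))"
    by (rule sum_ennreal[symmetric]) (simp add: diam_power_def)
  also have "\<dots> \<le> (\<Sum>i. ennreal (diam_power s0 (U i)))"
    using I(2) by (intro sum_le_suminf) auto
  also have "\<dots> < ennreal \<epsilon>" by (rule U(4))
  finally have sum1: "(\<Sum>i\<in>I. diam_power s0 (U i)) < \<epsilon>"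
    by (simp add: ennreal_less_iff sum_nonneg diam_power_def)
  have "(\<Sum>i\<in>I. (1 / 2 :: real) ^ Suc i) \<le> (\<Sum>i. (1 / 2) ^ Suc i)"
    using I(2) power_half_series by (intro sum_le_suminf) (auto simp: sums_iff)
  also have "\<dots> = 1" using power_half_series by (simp add: sums_iff)
  finally have sum2: "(\<Sum>i\<in>I. \<epsilon> * (1 / 2) ^ Suc i) \<le> \<epsilon>"
    unfolding sum_distrib_left[symmetric] using \<epsilon>(1) by simp
  have "(\<Sum>i\<in>I. A powr - (real (m i) * s)) \<le> (\<Sum>i\<in>I. A powr s * (diam_power s0 (U i) + \<epsilon> * (1 / 2) ^ Suc i))"
  proof (rule sum_mono)
    fix i assume i: "i \<in> I"
    have "A powr - (real (m i) * s) = (A powr - real (m i)) powr s" by (simp add: powr_powr)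
    also have "\<dots> \<le> (A * \<rho> i) powr s" using m(2)[of i] assms(4) by (intro powr_mono2) auto
    also have "\<dots> = A powr s * \<rho> i powr s" using assms(5) \<rho>[of i] by (simp add: powr_mult)
    also have "\<dots> \<le> A powr s * (diam_power s0 (U i) + \<epsilon> * (1 / 2) ^ Suc i)"
      using I(1) i \<rho>_powr by (intro mult_left_mono) auto
    finally show "A powr - (real (m i) * s) \<le> A powr s * (diam_power s0 (U i) + \<epsilon> * (1 / 2) ^ Suc i)" .
  qed
  also have "\<dots> = A powr s * ((\<Sum>i\<in>I. diam_power s0 (U i)) + (\<Sum>i\<in>I. \<epsilon> * (1 / 2) ^ Suc i))"
    by (simp only: sum_distrib_left[symmetric] sum.distrib)
  also have "\<dots> < A powr s * (\<epsilon> + \<epsilon>)" using sum1 sum2 assms(5) by (intro mult_strict_left_mono) auto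
  also have "\<dots> \<le> \<eta>" using \<epsilon>(3) by (simp add: algebra_simps)
  finally show ?thesis using that I(2,3) by blast
qed

section \<open>Words of base-a digits\<close>

text \<open>For \<open>a \<ge> 2\<close> this is the block of \<open>l\<close> base-\<open>a\<close>
  digits of \<open>v\<close> after position \<open>n\<close>, encoded as an integer below
  \<open>a ^ l\<close>. Leading zeros are invisible in the code, so the length has to be kept
  alongside.\<close>

definition word :: "int \<Rightarrow> real \<Rightarrow> nat \<Rightarrow> nat \<Rightarrow> int" where
  "word a v l n = \<lfloor>of_int (a ^ l) * frac (of_int (a ^ n) * v)\<rfloor>"

lemma word_0 [simp]: "word a v 0 n = 0"
  using frac_lt_1[of "of_int (a ^ n) * v"] by (simp add: word_def floor_eq_iff)

text \<open>Concatenation of digit blocks: the fractional part of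
  \<open>a ^ l * frac (a ^ n * v)\<close> is that of \<open>a ^ (n + l) * v\<close>, since the two
  numbers differ by an integer.\<close>

lemma word_add: "word a v (l + k) n = a ^ k * word a v l n + word a v k (n + l)"
proof -
  define y where "y = of_int (a ^ l) * frac (of_int (a ^ n) * v)"
  define z where "z = of_int (a ^ (n + l)) * v"
  have "z = y + of_int (a ^ l * \<lfloor>of_int (a ^ n) * v\<rfloor>)"
    by (simp add: y_def z_def frac_def power_add algebra_simps)
  then have z: "frac z = y - of_int \<lfloor>y\<rfloor>"
    by (simp only: frac_def floor_add_int) simp
  have "of_int (a ^ (l + k)) * frac (of_int (a ^ n) * v) = of_int (a ^ k) * y"
    by (simp add: y_def power_add)
  also have "\<dots> = of_int (a ^ k * \<lfloor>y\<rfloor>) + of_int (a ^ k) * frac z"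
    by (simp add: z right_diff_distrib)
  finally have "word a v (l + k) n = \<lfloor>of_int (a ^ k * \<lfloor>y\<rfloor>) + of_int (a ^ k) * frac z\<rfloor>"
    unfolding word_def by (rule arg_cong)
  also have "\<dots> = a ^ k * \<lfloor>y\<rfloor> + \<lfloor>of_int (a ^ k) * frac z\<rfloor>" by linarith
  finally show ?thesis by (simp only: word_def y_def z_def)
qed

lemma word_range:
  assumes "a \<ge> 1"
  shows "word a v l n \<in> {0..<a ^ l}"
proof -
  have "of_int (a ^ l) * frac (of_int (a ^ n) * v) < real_of_int (a ^ l) * 1"
    using assms by (intro mult_strict_left_mono frac_lt_1) auto
  moreover have "0 \<le> of_int (a ^ l) * frac (of_int (a ^ n) * v)"
    using assms by simp
  ultimately show ?thesis
    unfolding word_def atLeastLessThan_iff zero_le_floor floor_less_iff by simp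
qed

lemma finite_words: "a \<ge> 1 \<Longrightarrow> finite (word a v l ` D)"
  by (rule finite_subset[of _ "{0..<a ^ l}"]) (auto simp del: atLeastLessThan_iff intro: word_range)

text \<open>Growth exponent 1, the start of the iteration.\<close>

lemma card_words_le:
  assumes "a \<ge> 1"
  shows "real (card (range (word a v l))) \<le> of_int a ^ l"
proof -
  have "card (range (word a v l)) \<le> card {0..<a ^ l}"
    by (intro card_mono image_subsetI word_range assms) auto
  moreover have "0 \<le> a ^ l" using assms by simp
  ultimately have "int (card (range (word a v l))) \<le> a ^ l" by simp
  then show ?thesis by (metis of_int_le_iff of_int_of_nat_eq of_int_power)
qed

lemma word_approx:
  assumes "a \<ge> 1"
  shows "\<bar>frac (of_int (a ^ n) * v) - of_int (word a v l n) / of_int a ^ l\<bar> < 1 / of_int a ^ l"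
proof -
  define y where "y = frac (of_int (a ^ n) * v)"
  have "of_int (word a v l n) \<le> of_int a ^ l * y" "of_int a ^ l * y < of_int (word a v l n) + 1"
    by (simp_all add: word_def y_def)
  moreover have "0 < real_of_int a ^ l" using assms by simp
  ultimately have "of_int (word a v l n) / of_int a ^ l \<le> y" "y < (of_int (word a v l n) + 1) / of_int a ^ l"
    by (simp_all add: pos_divide_le_eq pos_less_divide_eq mult.commute)
  then show ?thesis
    using \<open>0 < real_of_int a ^ l\<close> unfolding y_def[symmetric] by (simp add: add_divide_distrib abs_less_iff)
qed

section \<open>Counting words by parsing\<close>

text \<open>
  The words seen from position \<open>j\<close> on are parsed from left to right. At a good position the parse
  reads a whole code word, and the total weight of the possible code words is at most 1; at a bad
  one it reads a single digit, which loses at most a factor \<open>a powr (1 - t)\<close>. So it does not matter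
  which positions the parse happens to visit, only how many bad ones there are.
\<close>

lemma card_parsed_words_le:
  fixes E :: "nat \<Rightarrow> 'c set" and len :: "'c \<Rightarrow> nat" and wd :: "'c \<Rightarrow> int"
    and a :: int and D :: "nat set" and t :: real
  assumes a: "a \<ge> 2" and t: "t \<le> 1"
    and fin: "\<And>j. finite (E j)"
    and len: "\<And>j e. e \<in> E j \<Longrightarrow> 1 \<le> len e \<and> len e \<le> M"
    and parse: "\<And>n j. n \<in> D \<Longrightarrow> \<exists>e\<in>E j. word a v (len e) (n + j) = wd e"
  defines "Bad \<equiv> {j. (\<Sum>e\<in>E j. of_int a powr - (real (len e) * t)) > 1}"
  shows "real (card ((\<lambda>n. word a v l (n + j)) ` D))
    \<le> of_int a powr (\<bar>t\<bar> * real M + t * real l + (1 - t) * real (card (Bad \<inter> {j..<j + l})))"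
proof (induction l arbitrary: j rule: less_induct)
  case (less l)
  define A where "A = real_of_int a"
  have A: "A \<ge> 2" using a by (simp add: A_def)
  define X where "X j l = (\<lambda>n. word a v l (n + j)) ` D" for j l
  define b where "b j l = real (card (Bad \<inter> {j..<j + l}))" for j l
  \<comment> \<open>Each remaining digit is charged \<open>t\<close> and each bad position another
    \<open>1 - t\<close>. The slack \<open>\<bar>t\<bar> * M\<close> is for a last code word that
    overruns the end; \<open>t\<close> may be negative.\<close>
  define B where "B j l = A powr (\<bar>t\<bar> * real M + t * real l + (1 - t) * b j l)" for j l
  have b0: "0 \<le> b j l" for j l by (simp add: b_def)
  have finX: "finite (X j l)" for j l
    using finite_words[of a v l "(\<lambda>n. n + j) ` D"] a by (simp add: X_def image_image)
  have IH: "real (card (X j' l')) \<le> B j' l'" if "l' < l" for j' l'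
    using less.IH[OF that] by (simp add: X_def B_def b_def A_def)
  have "real (card (X j l)) \<le> B j l"
  proof (cases "l = 0")
    case True
    have "card (X j l) \<le> card {0::int}" by (intro card_mono) (auto simp: X_def True)
    moreover have "1 \<le> B j l" unfolding B_def using A t b0 by (intro ge_one_powr_ge_zero) (auto simp: True)
    ultimately show ?thesis by simp
  next
    case l: False
    show ?thesis
    proof (cases "j \<in> Bad")
      case True
      \<comment> \<open>At a bad position one digit is split off, with \<open>a\<close> choices. The
        factor \<open>A\<close> is the charge \<open>t\<close> for that digit together with the
        \<open>1 - t\<close> for the bad position.\<close>
      have "X j l \<subseteq> (\<lambda>(d, w). a ^ (l - 1) * d + w) ` ({0..<a} \<times> X (j + 1) (l - 1))"
      proof
        fix x assume "x \<in> X j l"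
        then obtain n where n: "n \<in> D" "x = word a v l (n + j)" by (auto simp: X_def)
        have "x = a ^ (l - 1) * word a v 1 (n + j) + word a v (l - 1) (n + (j + 1))"
          using word_add[of a v 1 "l - 1" "n + j"] l n by simp
        moreover have "word a v 1 (n + j) \<in> {0..<a}" using word_range[of a v 1 "n + j"] a by simp
        moreover have "word a v (l - 1) (n + (j + 1)) \<in> X (j + 1) (l - 1)" using n(1) by (simp add: X_def)
        ultimately show "x \<in> (\<lambda>(d, w). a ^ (l - 1) * d + w) ` ({0..<a} \<times> X (j + 1) (l - 1))"
          by (intro image_eqI[of _ _ "(word a v 1 (n + j), word a v (l - 1) (n + (j + 1)))"]) auto
      qed
      then have "card (X j l) \<le> card ({0..<a} \<times> X (j + 1) (l - 1))"
        by (intro surj_card_le finite_cartesian_product finX) auto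
      then have "real (card (X j l)) \<le> real (nat a) * real (card (X (j + 1) (l - 1)))"
        by (simp add: card_cartesian_product flip: of_nat_mult)
      also have "\<dots> \<le> A * B (j + 1) (l - 1)"
        using a A IH[of "l - 1" "j + 1"] l by (intro mult_mono) (auto simp: A_def)
      also have "\<dots> = A powr (1 + (\<bar>t\<bar> * real M + t * real (l - 1) + (1 - t) * b (j + 1) (l - 1)))"
        using A by (simp add: B_def powr_add)
      also have "\<dots> = B j l"
      proof -
        have "Bad \<inter> {j..<j + l} = insert j (Bad \<inter> {j + 1..<j + 1 + (l - 1)})"
          using True l by auto
        then have "b j l = b (j + 1) (l - 1) + 1" by (simp add: b_def)
        moreover have "real (l - 1) = real l - 1" using l by simp
        ultimately show ?thesis by (simp add: B_def algebra_simps)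
      qed
      finally show ?thesis .
    next
      case False
      \<comment> \<open>The words that start with the code word \<open>e\<close>, or that end inside
        it if \<open>len e > l\<close>.\<close>
      define Y where "Y e = {word a v l (n + j) | n. n \<in> D \<and> word a v (len e) (n + j) = wd e}" for e
      have Y: "real (card (Y e)) \<le> A powr - (real (len e) * t) * B j l" if e: "e \<in> E j" for e
      proof -
        note le = len[OF e]
        have rhs: "A powr - (real (len e) * t) * B j l = A powr (\<bar>t\<bar> * real M + t * (real l - real (len e)) + (1 - t) * b j l)"
          unfolding B_def powr_add[symmetric] by (rule arg_cong[of _ _ "\<lambda>x. A powr x"]) (simp add: algebra_simps)
        show ?thesis
        proof (cases "len e \<le> l")
          case True
          have "Y e \<subseteq> (\<lambda>w. a ^ (l - len e) * wd e + w) ` X (j + len e) (l - len e)"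
          proof
            fix x assume "x \<in> Y e"
            then obtain n where n: "n \<in> D" "x = word a v l (n + j)" "word a v (len e) (n + j) = wd e"
              by (auto simp: Y_def)
            have "x = a ^ (l - len e) * wd e + word a v (l - len e) (n + (j + len e))"
              using word_add[of a v "len e" "l - len e" "n + j"] True n by (simp add: add.assoc)
            then show "x \<in> (\<lambda>w. a ^ (l - len e) * wd e + w) ` X (j + len e) (l - len e)"
              using n(1) by (auto simp: X_def)
          qed
          then have "card (Y e) \<le> card (X (j + len e) (l - len e))"
            by (rule surj_card_le[OF finX])
          then have "real (card (Y e)) \<le> real (card (X (j + len e) (l - len e)))" by simp
          also have "\<dots> \<le> B (j + len e) (l - len e)"
            using le l by (intro IH) auto
          also have "\<dots> \<le> A powr (\<bar>t\<bar> * real M + t * (real l - real (len e)) + (1 - t) * b j l)"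
          proof -
            have "b (j + len e) (l - len e) \<le> b j l"
              unfolding b_def using True by (intro of_nat_mono card_mono) auto
            then have "(1 - t) * b (j + len e) (l - len e) \<le> (1 - t) * b j l"
              using t by (intro mult_left_mono) auto
            then show ?thesis unfolding B_def using A True by (intro powr_mono) (auto simp: of_nat_diff)
          qed
          finally show ?thesis unfolding rhs .
        next
          case False
          \<comment> \<open>The word is an initial segment of the code word and hence unique; the
            slack makes the right-hand side at least 1.\<close>
          have "Y e \<subseteq> {wd e div a ^ (len e - l)}"
          proof
            fix x assume "x \<in> Y e"
            then obtain n where n: "n \<in> D" "x = word a v l (n + j)" "word a v (len e) (n + j) = wd e"
              by (auto simp: Y_def)
            have "wd e = a ^ (len e - l) * x + word a v (len e - l) (n + j + l)"
              using word_add[of a v l "len e - l" "n + j"] False n by simp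
            moreover have "word a v (len e - l) (n + j + l) \<in> {0..<a ^ (len e - l)}"
              using a by (intro word_range) simp
            ultimately show "x \<in> {wd e div a ^ (len e - l)}" using a by simp
          qed
          then have "card (Y e) \<le> card {wd e div a ^ (len e - l)}" by (intro card_mono) auto
          then have "real (card (Y e)) \<le> 1" by simp
          also have "1 \<le> A powr (\<bar>t\<bar> * real M + t * (real l - real (len e)) + (1 - t) * b j l)"
          proof (rule ge_one_powr_ge_zero)
            have "- t * (real (len e) - real l) \<ge> - \<bar>t\<bar> * real M"
            proof -
              have "t * (real (len e) - real l) \<le> \<bar>t\<bar> * (real (len e) - real l)"
                using False by (intro mult_right_mono) auto
              also have "\<dots> \<le> \<bar>t\<bar> * real M" using le by (intro mult_left_mono) auto
              finally show ?thesis by simp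
            qed
            moreover have "0 \<le> (1 - t) * b j l" using t b0 by simp
            ultimately show "0 \<le> \<bar>t\<bar> * real M + t * (real l - real (len e)) + (1 - t) * b j l"
              by (simp add: algebra_simps)
          qed (use A in simp)
          finally show ?thesis unfolding rhs .
        qed
      qed
      have Yfin: "finite (Y e)" for e
        by (rule finite_subset[OF _ finX[of j l]]) (auto simp: Y_def X_def)
      have "X j l \<subseteq> (\<Union>e\<in>E j. Y e)"
      proof
        fix x assume "x \<in> X j l"
        then obtain n where n: "n \<in> D" "x = word a v l (n + j)" by (auto simp: X_def)
        with parse[OF n(1), of j] show "x \<in> (\<Union>e\<in>E j. Y e)" unfolding Y_def by blast
      qed
      then have "card (X j l) \<le> card (\<Union>e\<in>E j. Y e)"
        using fin Yfin by (intro card_mono) auto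
      also have "\<dots> \<le> (\<Sum>e\<in>E j. card (Y e))" by (rule card_UN_le[OF fin])
      finally have "real (card (X j l)) \<le> (\<Sum>e\<in>E j. real (card (Y e)))"
        by (simp flip: of_nat_sum)
      also have "\<dots> \<le> (\<Sum>e\<in>E j. A powr - (real (len e) * t) * B j l)" by (intro sum_mono Y)
      also have "\<dots> = (\<Sum>e\<in>E j. A powr - (real (len e) * t)) * B j l" by (simp add: sum_distrib_right)
      \<comment> \<open>The Kraft inequality at the good position \<open>j\<close>.\<close>
      also have "\<dots> \<le> 1 * B j l"
        using False by (intro mult_right_mono) (auto simp: Bad_def A_def B_def)
      finally show ?thesis by simp
    qed
  qed
  then show ?case by (simp add: X_def B_def b_def A_def)
qed

section \<open>Improving the growth exponent of the words\<close>

text \<open>One round of the iteration. The Kraft exponent \<open>t = h - (1 - s)\<close> would gain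
  \<open>1 - s\<close>; bad positions are made rare enough to cost at most half of this. Covers are
  assumed for every \<open>\<eta>\<close> because the required \<open>\<eta>\<close> depends on
  \<open>C\<close>, which changes from round to round.\<close>

lemma card_words_growth_improves:
  fixes a :: int and v :: real and u :: circle
  defines "A \<equiv> real_of_int a"
  assumes irr: "circle_irrational u" and a: "a \<ge> 2" and s: "s < 1" and h: "h \<le> 1"
    and growth: "\<And>l. real (card (range (word a v l))) \<le> C * A powr (h * real l)"
    and cover: "\<And>\<eta>. \<eta> > 0 \<Longrightarrow> \<exists>(I :: nat set) (c :: nat \<Rightarrow> circle) m. finite I \<and>
      (\<forall>n. \<exists>i\<in>I. dist (circle_mult (int n) u + circle_of (of_int (a ^ n) * v)) (c i) < 2 * A powr - real (m i)) \<and>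
      (\<Sum>i\<in>I. A powr - (real (m i) * s)) < \<eta>"
  shows "\<exists>C'. \<forall>l. real (card (range (word a v l))) \<le> C' * A powr ((h - (1 - s) / 2) * real l)"
proof -
  have A: "A \<ge> 2" using a by (simp add: A_def)
  define \<theta> where "\<theta> n = circle_mult (int n) u" for n
  have \<theta>_add: "\<theta> (m + n) = \<theta> m + \<theta> n" for m n
    by (simp add: \<theta>_def circle_mult_add)
  define t where "t = h - (1 - s)"
  define \<delta> where "\<delta> = (1 - s) / 2"
  have t: "t < 1" and \<delta>: "\<delta> > 0" using s h by (auto simp: t_def \<delta>_def)
  have "range (word a v 0) = {0}" by auto
  then have C: "C \<ge> 1" using growth[of 0] A by simp
  \<comment> \<open>Chosen so that the bad positions cost at most \<open>\<delta>\<close> per digit;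
    the bound by 1 excludes \<open>m i = 0\<close>, so every code word has positive length.\<close>
  define \<eta> where "\<eta> = min 1 (\<delta> / (32 * C * (1 - t)))"
  have \<eta>: "0 < \<eta>" "\<eta> \<le> 1" "(1 - t) * (32 * C * \<eta>) \<le> \<delta>"
  proof -
    have pos: "0 < 32 * C * (1 - t)" using C t by simp
    then show "0 < \<eta>" "\<eta> \<le> 1" using \<delta> by (simp_all add: \<eta>_def)
    have "32 * C * (1 - t) * \<eta> \<le> 32 * C * (1 - t) * (\<delta> / (32 * C * (1 - t)))"
      using pos by (intro mult_left_mono) (auto simp: \<eta>_def)
    also have "\<dots> = \<delta>" using pos by (subst times_divide_eq_right, subst nonzero_mult_div_cancel_left) linarith+
    finally show "(1 - t) * (32 * C * \<eta>) \<le> \<delta>" by (simp add: mult_ac)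
  qed
  obtain I :: "nat set" and c :: "nat \<Rightarrow> circle" and m where I: "finite I"
    and c: "\<And>n. \<exists>i\<in>I. dist (\<theta> n + circle_of (of_int (a ^ n) * v)) (c i) < 2 * A powr - real (m i)"
    and sum_\<eta>: "(\<Sum>i\<in>I. A powr - (real (m i) * s)) < \<eta>"
    using cover[OF \<eta>(1)] unfolding \<theta>_def by blast
  have m_pos: "1 \<le> m i" if "i \<in> I" for i
  proof (rule ccontr)
    assume "\<not> 1 \<le> m i"
    then have "1 = A powr - (real (m i) * s)" using A by simp
    also have "\<dots> \<le> (\<Sum>i\<in>I. A powr - (real (m i) * s))"
      using that I by (intro member_le_sum) auto
    finally show False using sum_\<eta> \<eta>(2) by simp
  qed
  define M where "M = sum m I"
  have M: "m i \<le> M" if "i \<in> I" for i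
    unfolding M_def using that I by (intro member_le_sum) auto
  \<comment> \<open>A code word is an arc of the cover together with a word of the matching length
    that occurs in \<open>v\<close>.\<close>
  define F where "F = (SIGMA i:I. range (word a v (m i)))"
  have F: "finite F" unfolding F_def using I a by (intro finite_SigmaI finite_words) auto
  define q where "q e = circle_of (of_int (snd e) / A ^ m (fst e))" for e :: "nat \<times> int"
  \<comment> \<open>The code words compatible with the phase at time \<open>n\<close>. The radius 4
    is 2 from the cover, 1 from truncating the digits and 1 from replacing the phase by a nearby
    one.\<close>
  define E where "E n = {e\<in>F. dist (\<theta> n + q e) (c (fst e)) < 4 * A powr - real (m (fst e))}" for n
  define wt where "wt e = A powr - (real (m (fst e)) * t)" for e :: "nat \<times> int"
  have finE: "finite (E n)" for n using F by (simp add: E_def)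
  have wt0: "0 \<le> wt e" for e by (simp add: wt_def)

  \<comment> \<open>For fixed \<open>e\<close>, compatibility says that the phase lies in one fixed
    arc, so the visit bound applies with \<open>32 = 8 * 4\<close>.\<close>
  have "\<exists>K. \<forall>k L. real (card {n\<in>{k..<k + L}. e \<in> E n}) \<le> 32 * A powr - real (m (fst e)) * real L + K"
    if "e \<in> F" for e
  proof -
    obtain K where K: "\<And>p k L. real (card {n\<in>{k..<k + L}. dist (\<theta> n) p < 4 * A powr - real (m (fst e))})
        \<le> 8 * (4 * A powr - real (m (fst e))) * real L + K"
      using irrational_visits[OF irr, of "4 * A powr - real (m (fst e))"] A unfolding \<theta>_def by auto
    have "e \<in> E n \<longleftrightarrow> dist (\<theta> n) (c (fst e) - q e) < 4 * A powr - real (m (fst e))" for n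
      using that dist_circle_add_right[of "\<theta> n" "q e" "c (fst e) - q e"] by (simp add: E_def)
    then show ?thesis using K[of _ _ "c (fst e) - q e"] by (intro exI[of _ K]) simp
  qed
  then have "\<forall>e\<in>F. \<exists>K. \<forall>k L. real (card {n\<in>{k..<k + L}. e \<in> E n})
      \<le> 32 * A powr - real (m (fst e)) * real L + K"
    by (rule ballI)
  from bchoice[OF this] obtain K where K: "\<And>e k L. e \<in> F \<Longrightarrow>
      real (card {n\<in>{k..<k + L}. e \<in> E n}) \<le> 32 * A powr - real (m (fst e)) * real L + K e"
    by blast

  \<comment> \<open>Weight times visit frequency: up to the bounded error \<open>C1\<close>, this
    bounds the mean over a window of the total weight of \<open>E n\<close>.\<close>
  define \<beta> where "\<beta> = (\<Sum>e\<in>F. wt e * (32 * A powr - real (m (fst e))))"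
  define C1 where "C1 = (\<Sum>e\<in>F. wt e * K e)"
  have "\<beta> = (\<Sum>i\<in>I. \<Sum>w\<in>range (word a v (m i)). 32 * (A powr - (real (m i) * t) * A powr - real (m i)))"
    unfolding \<beta>_def F_def using I a
    by (subst sum.Sigma) (auto simp: wt_def finite_words intro!: sum.cong)
  also have "\<dots> = (\<Sum>i\<in>I. 32 * (real (card (range (word a v (m i)))) * (A powr - (real (m i) * t) * A powr - real (m i))))"
    by (simp add: mult_ac)
  \<comment> \<open>The number of words, the weight and the arc length contribute the exponents
    \<open>h\<close>, \<open>- t\<close> and \<open>- 1\<close> per digit, and
    \<open>h - t - 1 = - s\<close>.\<close>
  also have "\<dots> \<le> (\<Sum>i\<in>I. 32 * (C * A powr - (real (m i) * s)))"
  proof (rule sum_mono)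
    fix i
    have "real (card (range (word a v (m i)))) * (A powr - (real (m i) * t) * A powr - real (m i))
       \<le> (C * A powr (h * real (m i))) * (A powr - (real (m i) * t) * A powr - real (m i))"
      by (intro mult_right_mono growth) auto
    also have "\<dots> = C * A powr (h * real (m i) + (- (real (m i) * t) + - real (m i)))"
      by (simp only: powr_add mult.assoc)
    also have "h * real (m i) + (- (real (m i) * t) + - real (m i)) = - (real (m i) * s)"
      by (simp add: t_def algebra_simps)
    finally show "32 * (real (card (range (word a v (m i)))) * (A powr - (real (m i) * t) * A powr - real (m i)))
       \<le> 32 * (C * A powr - (real (m i) * s))" by simp
  qed
  also have "\<dots> = 32 * C * (\<Sum>i\<in>I. A powr - (real (m i) * s))"
    by (simp add: sum_distrib_left mult_ac)
  also have "\<dots> \<le> 32 * C * \<eta>" using sum_\<eta> C by (intro mult_left_mono) auto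
  finally have "(1 - t) * \<beta> \<le> (1 - t) * (32 * C * \<eta>)" using t by (intro mult_left_mono) auto
  with \<eta>(3) have \<beta>: "(1 - t) * \<beta> \<le> \<delta>" by linarith

  define Bad where "Bad = {n. (\<Sum>e\<in>E n. wt e) > 1}"
  \<comment> \<open>Markov's inequality: every bad position contributes more than 1 to the double
    sum of weights, which is then summed over positions first.\<close>
  have bad: "real (card (Bad \<inter> {k..<k + L})) \<le> \<beta> * real L + C1" for k L
  proof -
    have "real (card (Bad \<inter> {k..<k + L})) = (\<Sum>n\<in>Bad \<inter> {k..<k + L}. 1)" by simp
    also have "\<dots> \<le> (\<Sum>n\<in>Bad \<inter> {k..<k + L}. \<Sum>e\<in>E n. wt e)"
      by (intro sum_mono) (auto simp: Bad_def)
    also have "\<dots> \<le> (\<Sum>n\<in>{k..<k + L}. \<Sum>e\<in>E n. wt e)"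
      by (intro sum_mono2) (auto intro!: sum_nonneg wt0)
    also have "\<dots> = (\<Sum>n\<in>{k..<k + L}. \<Sum>e\<in>{e\<in>F. e \<in> E n}. wt e)"
      by (intro sum.cong) (auto simp: E_def)
    also have "\<dots> = (\<Sum>e\<in>F. \<Sum>n\<in>{n\<in>{k..<k + L}. e \<in> E n}. wt e)"
      using F by (intro sum.swap_restrict) auto
    also have "\<dots> = (\<Sum>e\<in>F. wt e * real (card {n\<in>{k..<k + L}. e \<in> E n}))"
      by (simp add: mult.commute)
    also have "\<dots> \<le> (\<Sum>e\<in>F. wt e * (32 * A powr - real (m (fst e)) * real L + K e))"
      by (intro sum_mono mult_left_mono K wt0)
    also have "\<dots> = \<beta> * real L + C1"
      by (simp add: \<beta>_def C1_def sum_distrib_right sum.distrib distrib_left mult.assoc)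
    finally show ?thesis .
  qed

  \<comment> \<open>The mesh is at most every \<open>A powr - real (m i)\<close>. Rotation is an
    isometry, so if the phases at \<open>n\<close> and \<open>n0\<close> are close, so are those at
    \<open>n + j\<close> and \<open>n0 + j\<close> for all \<open>j\<close>; hence the sets
    \<open>E (n0 + j)\<close> serve to parse from every \<open>n\<close> in
    \<open>D n0\<close>.\<close>
  obtain N where N: "finite N" "\<And>n. \<exists>n0\<in>N. dist (\<theta> n) (\<theta> n0) < A powr - real M"
    using finite_net_range[of "A powr - real M" \<theta>] A by auto
  define D where "D n0 = {n. dist (\<theta> n) (\<theta> n0) < A powr - real M}" for n0
  define C' where "C' = A powr (\<bar>t\<bar> * real M + (1 - t) * C1)"
  have bound: "real (card (word a v l ` D n0)) \<le> C' * A powr ((h - \<delta>) * real l)" for n0 l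
  proof -
    define b where "b = real (card ({j. (\<Sum>e\<in>E (n0 + j). real_of_int a powr - (real (m (fst e)) * t)) > 1} \<inter> {0..<0 + l}))"
    have parse: "\<exists>e\<in>E (n0 + j). word a v (m (fst e)) (n + j) = snd e" if n: "n \<in> D n0" for n j
    proof -
      define y where "y = of_int (a ^ (n + j)) * v"
      obtain i where i: "i \<in> I" "dist (\<theta> (n + j) + circle_of y) (c i) < 2 * A powr - real (m i)"
        using c unfolding y_def by blast
      define w where "w = word a v (m i) (n + j)"
      define x where "x = of_int w / A ^ m i"
      have Apow: "A powr - real (m i) = 1 / A ^ m i"
        using A by (simp add: powr_minus powr_realpow divide_inverse)
      have "dist (\<theta> (n0 + j) + circle_of x) (\<theta> (n + j) + circle_of x) = dist (\<theta> n0) (\<theta> n)"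
        by (simp only: \<theta>_add dist_circle_add_right)
      also have "\<dots> < A powr - real M" using n by (simp add: D_def dist_commute)
      also have "\<dots> \<le> A powr - real (m i)" using A M[OF i(1)] by (intro powr_mono) auto
      finally have d1: "dist (\<theta> (n0 + j) + circle_of x) (\<theta> (n + j) + circle_of x) < A powr - real (m i)" .
      have "dist (\<theta> (n + j) + circle_of x) (\<theta> (n + j) + circle_of y) = dist (circle_of (frac y)) (circle_of x)"
        by (simp only: dist_circle_add_left circle_of_frac dist_commute)
      also have "\<dots> \<le> \<bar>frac y - x\<bar>" by (rule dist_circle_of_le)
      also have "\<dots> < A powr - real (m i)"
        using word_approx[of a "n + j" v "m i"] a unfolding Apow unfolding x_def w_def y_def A_def by simp
      finally have d2: "dist (\<theta> (n + j) + circle_of x) (\<theta> (n + j) + circle_of y) < A powr - real (m i)" .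
      have "dist (\<theta> (n0 + j) + circle_of x) (c i) < 4 * A powr - real (m i)"
        using d1 d2 i(2) dist_triangle[of "\<theta> (n0 + j) + circle_of x" "c i" "\<theta> (n + j) + circle_of x"]
          dist_triangle[of "\<theta> (n + j) + circle_of x" "c i" "\<theta> (n + j) + circle_of y"] by linarith
      then have "(i, w) \<in> E (n0 + j)"
        using i(1) by (simp add: E_def F_def q_def x_def w_def)
      then show ?thesis by (intro bexI[of _ "(i, w)"]) (simp_all add: w_def)
    qed
    have "real (card ((\<lambda>n. word a v l (n + 0)) ` D n0)) \<le> real_of_int a powr (\<bar>t\<bar> * real M + t * real l + (1 - t) * b)"
      unfolding b_def
    proof (rule card_parsed_words_le[where E = "\<lambda>j. E (n0 + j)" and len = "\<lambda>e. m (fst e)" and wd = snd])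
      fix j e assume "e \<in> E (n0 + j)"
      then have "fst e \<in> I" by (auto simp: E_def F_def)
      then show "1 \<le> m (fst e) \<and> m (fst e) \<le> M" using m_pos M by simp
    next
      show "\<exists>e\<in>E (n0 + j). word a v (m (fst e)) (n + j) = snd e" if "n \<in> D n0" for n j
        using that by (rule parse)
    qed (use a t finE in simp_all)
    also have "\<dots> \<le> A powr (\<bar>t\<bar> * real M + (1 - t) * C1 + (h - \<delta>) * real l)"
      unfolding A_def[symmetric]
    proof (rule powr_mono)
      \<comment> \<open>The parse counts positions from \<open>n0\<close>, so its bad positions are
        a translate of part of \<open>Bad\<close>.\<close>
      have "card ({j. (\<Sum>e\<in>E (n0 + j). wt e) > 1} \<inter> {0..<l}) \<le> card (Bad \<inter> {n0..<n0 + l})"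
        by (rule card_inj_on_le[of "(+) n0"]) (auto simp: Bad_def)
      then have "b \<le> real (card (Bad \<inter> {n0..<n0 + l}))" by (simp add: b_def wt_def A_def)
      also have "\<dots> \<le> \<beta> * real l + C1" by (rule bad)
      finally have "(1 - t) * b \<le> (1 - t) * (\<beta> * real l + C1)" using t by (intro mult_left_mono) auto
      also have "\<dots> = ((1 - t) * \<beta>) * real l + (1 - t) * C1" by (simp add: algebra_simps)
      also have "\<dots> \<le> \<delta> * real l + (1 - t) * C1" using \<beta> by (intro add_right_mono mult_right_mono) auto
      finally have "t * real l + (1 - t) * b \<le> (t + \<delta>) * real l + (1 - t) * C1" by (simp add: algebra_simps)
      also have "t + \<delta> = h - \<delta>" by (simp add: t_def \<delta>_def field_simps)
      finally show "\<bar>t\<bar> * real M + t * real l + (1 - t) * b \<le> \<bar>t\<bar> * real M + (1 - t) * C1 + (h - \<delta>) * real l"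
        by simp
    qed (use A in simp)
    also have "\<dots> = C' * A powr ((h - \<delta>) * real l)" by (simp add: C'_def powr_add)
    finally show ?thesis by simp
  qed
  have "real (card (range (word a v l))) \<le> real (card N) * C' * A powr ((h - \<delta>) * real l)" for l
  proof -
    have "range (word a v l) \<subseteq> (\<Union>n0\<in>N. word a v l ` D n0)"
    proof
      fix x assume "x \<in> range (word a v l)"
      then obtain n where n: "x = word a v l n" by blast
      obtain n0 where "n0 \<in> N" "n \<in> D n0" using N(2)[of n] unfolding D_def by blast
      then show "x \<in> (\<Union>n0\<in>N. word a v l ` D n0)" using n by blast
    qed
    then have "card (range (word a v l)) \<le> card (\<Union>n0\<in>N. word a v l ` D n0)"
      using N(1) a by (intro card_mono finite_UN_I finite_words) auto
    also have "\<dots> \<le> (\<Sum>n0\<in>N. card (word a v l ` D n0))" by (rule card_UN_le[OF N(1)])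
    finally have "real (card (range (word a v l))) \<le> (\<Sum>n0\<in>N. real (card (word a v l ` D n0)))"
      by (simp flip: of_nat_sum)
    also have "\<dots> \<le> (\<Sum>n0\<in>N. C' * A powr ((h - \<delta>) * real l))" by (intro sum_mono bound)
    also have "\<dots> = real (card N) * C' * A powr ((h - \<delta>) * real l)" by simp
    finally show ?thesis .
  qed
  then show ?thesis unfolding \<delta>_def by blast
qed

section \<open>Iteration and conclusion\<close>

lemma hausdorff_measure_orbit_neq_0:
  fixes u :: circle and v :: real and a :: int
  defines "S \<equiv> closure (range (\<lambda>n. circle_mult (int n) u + circle_of (of_int (a ^ n) * v)))"
  assumes irr: "circle_irrational u" and a: "a \<ge> 2" and s0: "0 \<le> s0" "s0 < 1"
  shows "hausdorff_measure s0 S \<noteq> 0"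
proof
  assume null: "hausdorff_measure s0 S = 0"
  define A where "A = real_of_int a"
  have A: "A \<ge> 2" using a by (simp add: A_def)
  \<comment> \<open>Above \<open>s0\<close>, so that cheap finite covers exist, and below 1, so that
    every round gains.\<close>
  define s where "s = (1 + s0) / 2"
  have s: "s0 < s" "0 < s" "s < 1" using s0 by (auto simp: s_def)
  have cpt: "compact S"
    using compact_Int_closed[OF compact_circle, of S] by (simp add: S_def)
  have cover: "\<exists>(I :: nat set) (c :: nat \<Rightarrow> circle) m. finite I \<and>
      (\<forall>n. \<exists>i\<in>I. dist (circle_mult (int n) u + circle_of (of_int (a ^ n) * v)) (c i) < 2 * A powr - real (m i)) \<and>
      (\<Sum>i\<in>I. A powr - (real (m i) * s)) < \<eta>" if \<eta>: "\<eta> > 0" for \<eta>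
  proof -
    obtain I and c :: "nat \<Rightarrow> circle" and m where *: "finite I" "S \<subseteq> (\<Union>i\<in>I. ball (c i) (2 * A powr - real (m i)))"
      "(\<Sum>i\<in>I. A powr - (real (m i) * s)) < \<eta>"
      by (rule hausdorff_null_finite_ball_cover[OF cpt null s(1,2) _ \<eta>, of A]) (use A in auto)
    have "\<exists>i\<in>I. dist (circle_mult (int n) u + circle_of (of_int (a ^ n) * v)) (c i) < 2 * A powr - real (m i)" for n
    proof -
      have "circle_mult (int n) u + circle_of (of_int (a ^ n) * v) \<in> S"
        unfolding S_def by (rule subsetD[OF closure_subset]) blast
      then have "circle_mult (int n) u + circle_of (of_int (a ^ n) * v) \<in> (\<Union>i\<in>I. ball (c i) (2 * A powr - real (m i)))"
        using *(2) by (rule rev_subsetD)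
      then obtain i where "i \<in> I" "circle_mult (int n) u + circle_of (of_int (a ^ n) * v) \<in> ball (c i) (2 * A powr - real (m i))"
        by (rule UN_E)
      then show ?thesis by (intro bexI[of _ i]) (simp_all only: mem_ball dist_commute)
    qed
    with * show ?thesis by (intro exI[of _ I] exI[of _ c] exI[of _ m]) simp
  qed
  \<comment> \<open>The gain per round depends on \<open>s\<close> alone, so finitely many rounds
    make the exponent negative.\<close>
  define \<delta> where "\<delta> = (1 - s) / 2"
  have \<delta>: "\<delta> > 0" using s by (simp add: \<delta>_def)
  have growth: "\<exists>C. \<forall>l. real (card (range (word a v l))) \<le> C * A powr ((1 - real k * \<delta>) * real l)" for k
  proof (induction k)
    case 0
    have "real (card (range (word a v l))) \<le> 1 * A powr ((1 - real 0 * \<delta>) * real l)" for l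
      using card_words_le[of a v l] a A by (simp add: A_def powr_realpow)
    then show ?case by blast
  next
    case (Suc k)
    then obtain C where C: "\<And>l. real (card (range (word a v l))) \<le> C * A powr ((1 - real k * \<delta>) * real l)"
      by blast
    have "1 - real k * \<delta> \<le> 1" using \<delta> by simp
    then have "\<exists>C'. \<forall>l. real (card (range (word a v l)))
        \<le> C' * real_of_int a powr ((1 - real k * \<delta> - (1 - s) / 2) * real l)"
      by (rule card_words_growth_improves[OF irr a s(3) _ C[unfolded A_def] cover[unfolded A_def]])
    then obtain C' where C': "\<And>l. real (card (range (word a v l))) \<le> C' * A powr ((1 - real k * \<delta> - \<delta>) * real l)"
      unfolding A_def \<delta>_def by blast
    have "1 - real k * \<delta> - \<delta> = 1 - real (Suc k) * \<delta>" by (simp add: algebra_simps)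
    from C'[unfolded this] show ?case by blast
  qed
  obtain k where "1 / \<delta> < real k" using reals_Archimedean2 by blast
  then have k: "1 - real k * \<delta> < 0" using \<delta> by (simp add: field_simps)
  obtain C where C: "\<And>l. real (card (range (word a v l))) \<le> C * A powr ((1 - real k * \<delta>) * real l)"
    using growth by blast
  define x where "x = A powr (1 - real k * \<delta>)"
  have x: "0 < x" "x < 1" using A k by (simp_all add: x_def powr_less_one)
  have "1 \<le> C * x ^ l" for l
  proof -
    \<comment> \<open>There is always at least one word of each length, which contradicts a bound
      tending to 0.\<close>
    have "card (range (word a v l)) \<noteq> 0" using finite_words[of a v l UNIV] a by simp
    then have "1 \<le> real (card (range (word a v l)))" by linarith
    also have "\<dots> \<le> C * A powr ((1 - real k * \<delta>) * real l)" by (rule C)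
    also have "A powr ((1 - real k * \<delta>) * real l) = x ^ l"
      using x(1) by (simp add: powr_realpow[symmetric] x_def powr_powr)
    finally show ?thesis .
  qed
  moreover have "(\<lambda>l. C * x ^ l) \<longlonglongrightarrow> C * 0"
    using x by (intro tendsto_mult_left LIMSEQ_realpow_zero) auto
  ultimately have "1 \<le> C * 0" by (intro LIMSEQ_le_const) auto
  then show False by simp
qed

theorem theorem3p1:
  fixes u v :: circle and a :: int
  assumes "circle_irrational u" and "a \<ge> 2"
  shows "hausdorff_dim (closure {circle_mult (int n) u + circle_mult (a ^ n) v | n :: nat. True}) = 1"
proof (rule antisym)
  obtain y where y: "v = circle_of y" by (rule circle_of_cases)
  have eq: "{circle_mult (int n) u + circle_mult (a ^ n) v | n :: nat. True} =
      range (\<lambda>n. circle_mult (int n) u + circle_of (of_int (a ^ n) * y))"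
    by (auto simp: y circle_mult_circle_of)
  show "1 \<le> hausdorff_dim (closure {circle_mult (int n) u + circle_mult (a ^ n) v | n :: nat. True})"
    unfolding hausdorff_dim_def eq
  proof (rule Inf_greatest, clarify)
    fix s :: real
    assume "0 \<le> s" "hausdorff_measure s
      (closure (range (\<lambda>n. circle_mult (int n) u + circle_of (of_int (a ^ n) * y)))) = 0"
    then have "1 \<le> s" using hausdorff_measure_orbit_neq_0[OF assms, of s y] by linarith
    then show "1 \<le> ennreal s" by simp
  qed
qed (rule hausdorff_dim_circle_le_1)

end
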